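(* Let $G$ be a finite group with $|G|=2^n$. If $G$ has no subgroup isomorphic to $D_4$ and no subgroup isomorphic to $\mathbb{Z}_2^3$, then $\Gamma(G)$ is planar.
   Context: For a finite group $G$, the prime order element graph $\Gamma(G)$ is the simple undirected graph with vertex set $G$ in which two distinct vertices $x,y\in G$ are adjacent if and only if the order of the product $xy$ is a prime number. $D_4$ denotes the dihedral group of order $8$ (in general $D_m$ is the dihedral group of order $2m$), and $\mathbb{Z}_2^3$ is the elementary abelian group of order $8$. *)

theory Defs
  imports "HOL-Analysis.Analysis" "HOL-Algebra.Algebra"
begin

text \<open>
  A simple undirected graph is given by its vertex set and its set of edges, each edge being
  a two-element set of vertices.
\<close>

type_synonym 'a ugraph = "'a set \<times> 'a set set"

text \<open>
  Planarity is meant topologically: the vertices are placed at distinct points of the plane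
  (here \<^typ>\<open>complex\<close>) and every edge is drawn as a simple arc joining its two ends, such that an arc
  passes through no other vertex and two different arcs meet only at the ends they share.
\<close>

definition planar_drawing :: "'a ugraph \<Rightarrow> ('a \<Rightarrow> complex) \<Rightarrow> ('a set \<Rightarrow> real \<Rightarrow> complex) \<Rightarrow> bool" where
  "planar_drawing \<Gamma> p \<gamma> \<longleftrightarrow>
     inj_on p (fst \<Gamma>) \<and>
     (\<forall>e\<in>snd \<Gamma>. arc (\<gamma> e) \<and> {pathstart (\<gamma> e), pathfinish (\<gamma> e)} = p ` e \<and>
                path_image (\<gamma> e) \<inter> p ` fst \<Gamma> = p ` e) \<and>
     (\<forall>e\<in>snd \<Gamma>. \<forall>f\<in>snd \<Gamma>. e \<noteq> f \<longrightarrow> path_image (\<gamma> e) \<inter> path_image (\<gamma> f) = p ` (e \<inter> f))"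

definition planar :: "'a ugraph \<Rightarrow> bool" where
  "planar \<Gamma> \<longleftrightarrow> (\<exists>p \<gamma>. planar_drawing \<Gamma> p \<gamma>)"

text \<open>
  In a group, \<open>x \<otimes> y\<close> and \<open>y \<otimes> x\<close> are conjugate and so have the same order. The adjacency condition
  below is therefore symmetric, although the edge \<open>{x, y}\<close> is unordered and the product is not.
\<close>

definition prime_order_element_graph :: "('a, 'b) monoid_scheme \<Rightarrow> 'a ugraph" where
  "prime_order_element_graph G =
     (carrier G,
      {{x, y} | x y. x \<in> carrier G \<and> y \<in> carrier G \<and> x \<noteq> y \<and>
                     Factorial_Ring.prime (group.ord G (x \<otimes>\<^bsub>G\<^esub> y))})"

text \<open>
  The dihedral group of order \<open>2 * m\<close>, for \<open>m \<ge> 1\<close>, as the semidirect product of the cyclic group of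
  order \<open>m\<close> with the group of order 2 acting by inversion. The element \<open>(a, s)\<close> stands for the rotation
  \<open>r\<^sup>a\<close> if \<open>s\<close> is false and for the reflection \<open>r\<^sup>a f\<close> if \<open>s\<close> is true, where \<open>f r = r\<^sup>-\<^sup>1 f\<close>.
\<close>

definition dihedral_group :: "nat \<Rightarrow> (int \<times> bool) monoid" where
  "dihedral_group m =
     \<lparr>carrier = {0..<int m} \<times> UNIV,
      mult = (\<lambda>(a, s) (b, t). ((if s then a - b else a + b) mod int m, s \<noteq> t)),
      one = (0, False)\<rparr>"

lemma group_dihedral_group:
  assumes "m \<ge> 1"
  shows "group (dihedral_group m)"
proof (rule groupI)
  fix x y z
  show "x \<otimes>\<^bsub>dihedral_group m\<^esub> y \<otimes>\<^bsub>dihedral_group m\<^esub> z =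
        x \<otimes>\<^bsub>dihedral_group m\<^esub> (y \<otimes>\<^bsub>dihedral_group m\<^esub> z)"
    by (cases x; cases y; cases z) (auto simp: dihedral_group_def mod_simps algebra_simps)
next
  fix x assume x: "x \<in> carrier (dihedral_group m)"
  obtain a s where [simp]: "x = (a, s)" by (cases x)
  define y where "y = (if s then (a, s) else ((- a) mod int m, s))"
  have "y \<in> carrier (dihedral_group m)" "y \<otimes>\<^bsub>dihedral_group m\<^esub> x = \<one>\<^bsub>dihedral_group m\<^esub>"
    using x assms by (auto simp: dihedral_group_def y_def mod_simps)
  then show "\<exists>y\<in>carrier (dihedral_group m). y \<otimes>\<^bsub>dihedral_group m\<^esub> x = \<one>\<^bsub>dihedral_group m\<^esub>"
    by blast
qed (use assms in \<open>auto simp: dihedral_group_def\<close>)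

lemma order_dihedral_group: "order (dihedral_group m) = 2 * m"
  by (simp add: order_def dihedral_group_def card_cartesian_product card_UNIV_bool)

definition has_subgroup_iso :: "('a, 'b) monoid_scheme \<Rightarrow> ('c, 'd) monoid_scheme \<Rightarrow> bool" where
  "has_subgroup_iso G K \<longleftrightarrow> (\<exists>H. subgroup H G \<and> G\<lparr>carrier := H\<rparr> \<cong> K)"

end

(*
  Two non-commuting involutions a, b of a 2-group generate a dihedral 2-group, and a suitable power
  of ab together with a generates a copy of D_4. So all involutions of G commute; with the identity
  they form an elementary abelian normal subgroup N, of order at most 4 since Z_2^3 does not embed.
  An edge {x, y} has xy in N - {1}, hence joins the coset Nx to its inverse coset. If Nx is its own
  inverse, this component lies in a K_4. Otherwise give y in the inverse coset the label of y^-1 in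
  Nx: then only vertices with different labels are adjacent, and the component lies in K_{4,4} minus
  a perfect matching, which is the graph of the cube. Both K_4 and the cube are subgraphs of the
  tetrahedron with a further vertex in each of its faces, joined to the corners of that face. Copies
  of this graph are drawn side by side with straight edges.
*)
theory Submission
  imports Defs
begin

section \<open>Straight-line drawings\<close>

lemma planar_straight_line:
  fixes p :: "'a \<Rightarrow> complex"
  assumes inj: "inj_on p V"
    and edges: "\<And>e. e \<in> E \<Longrightarrow> \<exists>x\<in>V. \<exists>y\<in>V. x \<noteq> y \<and> e = {x, y}"
    and vertex: "\<And>e v. e \<in> E \<Longrightarrow> v \<in> V \<Longrightarrow> p v \<in> convex hull (p ` e) \<Longrightarrow> v \<in> e"
    and cross: "\<And>e f z. e \<in> E \<Longrightarrow> f \<in> E \<Longrightarrow> e \<noteq> f \<Longrightarrow> z \<in> convex hull (p ` e) \<Longrightarrow>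
                  z \<in> convex hull (p ` f) \<Longrightarrow> z \<in> p ` (e \<inter> f)"
  shows "planar (V, E)"
proof -
  \<comment> \<open>Edges are unordered, whereas \<open>linepath\<close> needs a first and a last
    point, so an order of the two ends is chosen for each edge.\<close>
  obtain s t where st: "\<And>e. e \<in> E \<Longrightarrow> s e \<in> V \<and> t e \<in> V \<and> s e \<noteq> t e \<and> e = {s e, t e}"
    using edges by metis
  define \<gamma> where "\<gamma> e = linepath (p (s e)) (p (t e))" for e
  have image: "p ` e = {p (s e), p (t e)}" if "e \<in> E" for e
  proof -
    have "p ` e = p ` {s e, t e}"
      using st[OF that] by (intro arg_cong[where f = "image p"]) blast
    then show ?thesis
      by simp
  qed
  have hull: "path_image (\<gamma> e) = convex hull (p ` e)" if "e \<in> E" for e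
    unfolding image[OF that] by (simp add: \<gamma>_def segment_convex_hull)
  have sub: "e \<subseteq> V" if "e \<in> E" for e
    using edges[OF that] by blast
  have "planar_drawing (V, E) p \<gamma>"
    unfolding planar_drawing_def fst_conv snd_conv
  proof (intro conjI ballI impI)
    fix e assume e: "e \<in> E"
    have "p (s e) \<noteq> p (t e)"
      using st[OF e] inj_onD[OF inj, of "s e" "t e"] by blast
    then show "arc (\<gamma> e)"
      by (simp add: \<gamma>_def arc_linepath)
    show "{pathstart (\<gamma> e), pathfinish (\<gamma> e)} = p ` e"
      using image[OF e] by (simp add: \<gamma>_def)
    show "path_image (\<gamma> e) \<inter> p ` V = p ` e"
      using vertex[OF e] sub[OF e] hull_subset[of "p ` e" convex] by (auto simp: hull[OF e])
  next
    fix e f assume ef: "e \<in> E" "f \<in> E" "e \<noteq> f"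
    show "path_image (\<gamma> e) \<inter> path_image (\<gamma> f) = p ` (e \<inter> f)"
      using cross[OF ef] hull_subset[of "p ` e" convex] hull_subset[of "p ` f" convex]
      by (auto simp: hull ef)
  qed (rule inj)
  then show ?thesis
    by (auto simp: planar_def)
qed

text \<open>The arcs of the image edges can be reused: injectivity of \<open>\<phi>\<close> keeps
  distinct edges distinct and makes images commute with intersections. Non-edges may be sent to
  edges.\<close>

lemma planar_embedding:
  assumes "planar (V', E')" and inj: "inj_on \<phi> V" and sub: "\<phi> ` V \<subseteq> V'"
    and edges: "\<And>e. e \<in> E \<Longrightarrow> e \<subseteq> V \<and> \<phi> ` e \<in> E'"
  shows "planar (V, E)"
proof -
  obtain p \<gamma> where "planar_drawing (V', E') p \<gamma>"
    using assms(1) by (auto simp: planar_def)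
  then have p: "inj_on p V'"
    and arc: "\<And>e. e \<in> E' \<Longrightarrow> arc (\<gamma> e)"
    and ends: "\<And>e. e \<in> E' \<Longrightarrow> {pathstart (\<gamma> e), pathfinish (\<gamma> e)} = p ` e"
    and avoid: "\<And>e. e \<in> E' \<Longrightarrow> path_image (\<gamma> e) \<inter> p ` V' = p ` e"
    and cross: "\<And>e f. e \<in> E' \<Longrightarrow> f \<in> E' \<Longrightarrow> e \<noteq> f \<Longrightarrow>
                  path_image (\<gamma> e) \<inter> path_image (\<gamma> f) = p ` (e \<inter> f)"
    unfolding planar_drawing_def fst_conv snd_conv by blast+
  have "planar_drawing (V, E) (p \<circ> \<phi>) (\<lambda>e. \<gamma> (\<phi> ` e))"
    unfolding planar_drawing_def fst_conv snd_conv
  proof (intro conjI ballI impI)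
    show "inj_on (p \<circ> \<phi>) V"
      using inj p sub by (meson comp_inj_on inj_on_subset)
  next
    fix e assume e: "e \<in> E"
    have eE': "\<phi> ` e \<in> E'" and eV: "e \<subseteq> V"
      using edges[OF e] by blast+
    show "arc (\<gamma> (\<phi> ` e))"
      by (rule arc[OF eE'])
    show "{pathstart (\<gamma> (\<phi> ` e)), pathfinish (\<gamma> (\<phi> ` e))} = (p \<circ> \<phi>) ` e"
      unfolding ends[OF eE'] by (rule image_comp)
    have "p ` \<phi> ` V \<subseteq> p ` V'" "p ` \<phi> ` e \<subseteq> p ` \<phi> ` V"
      by (intro image_mono sub eV)+
    then show "path_image (\<gamma> (\<phi> ` e)) \<inter> (p \<circ> \<phi>) ` V = (p \<circ> \<phi>) ` e"
      using avoid[OF eE'] unfolding image_comp[symmetric] by blast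
  next
    fix e f assume ef: "e \<in> E" "f \<in> E" "e \<noteq> f"
    have sub: "e \<subseteq> V" "f \<subseteq> V" and img: "\<phi> ` e \<in> E'" "\<phi> ` f \<in> E'"
      using edges ef(1,2) by blast+
    have "\<phi> ` e \<noteq> \<phi> ` f"
      unfolding inj_on_image_eq_iff[OF inj sub] by (rule ef(3))
    then show "path_image (\<gamma> (\<phi> ` e)) \<inter> path_image (\<gamma> (\<phi> ` f)) = (p \<circ> \<phi>) ` (e \<inter> f)"
      unfolding cross[OF img \<open>\<phi> ` e \<noteq> \<phi> ` f\<close>] image_comp[symmetric]
        inj_on_image_Int[OF inj sub] by simp
  qed
  then show ?thesis
    by (auto simp: planar_def)
qed

section \<open>Orientation determinants and plane segments\<close>

text \<open>Twice the signed area of the triangle \<open>a\<close>, \<open>b\<close>,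
  \<open>c\<close>; the sign tells on which side of the line through \<open>a\<close> and
  \<open>b\<close> the point \<open>c\<close> lies.\<close>

definition orientation :: "complex \<Rightarrow> complex \<Rightarrow> complex \<Rightarrow> real" where
  "orientation a b c = Im (cnj (b - a) * (c - a))"

lemma orientation_simps [simp]: "orientation a b a = 0" "orientation a b b = 0"
  by (simp_all add: orientation_def algebra_simps)

text \<open>The determinant is affine in its third argument.\<close>

lemma orientation_convex:
  assumes "z \<in> closed_segment c d"
  obtains u where "0 \<le> u" "u \<le> 1" "z = (1 - u) *\<^sub>R c + u *\<^sub>R d"
    "orientation a b z = (1 - u) * orientation a b c + u * orientation a b d"
proof -
  obtain u where u: "0 \<le> u" "u \<le> 1" "z = (1 - u) *\<^sub>R c + u *\<^sub>R d"
    using assms by (auto simp: closed_segment_def)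
  show ?thesis
    by (rule that[OF u]) (simp add: u(3) orientation_def algebra_simps)
qed

lemma orientation_swap: "orientation b a c = - orientation a b c"
  by (simp add: orientation_def algebra_simps)

lemma orientation_segment: "z \<in> closed_segment a b \<Longrightarrow> orientation a b z = 0"
  by (erule orientation_convex[where a = a and b = b]) simp

text \<open>The points \<open>c\<close> and \<open>d\<close> lie strictly on one side of the line
  through \<open>a\<close> and \<open>b\<close>, and so does the whole segment between them.\<close>

lemma segments_disjoint:
  assumes "orientation a b c * orientation a b d > 0"
  shows "closed_segment a b \<inter> closed_segment c d = {}"
proof (rule ccontr)
  assume "closed_segment a b \<inter> closed_segment c d \<noteq> {}"
  then obtain z where z: "z \<in> closed_segment a b" "z \<in> closed_segment c d"
    by blast
  obtain u where u: "0 \<le> u" "u \<le> 1"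
    "orientation a b z = (1 - u) * orientation a b c + u * orientation a b d"
    using orientation_convex[OF z(2)] by metis
  define x y where "x = orientation a b c" and "y = orientation a b d"
  have "(1 - u) * x + u * y = 0" and xy: "x * y > 0"
    using u orientation_segment[OF z(1)] assms by (simp_all add: x_def y_def)
  \<comment> \<open>Multiplying by \<open>x\<close> makes both summands nonnegative, so both vanish,
    which forces \<open>u = 1\<close> and \<open>u = 0\<close> at once.\<close>
  then have "x * ((1 - u) * x + u * y) = 0"
    by simp
  then have "(1 - u) * (x * x) + u * (x * y) = 0"
    by (simp add: algebra_simps)
  moreover have "x * x > 0"
    using xy by (metis mult_zero_left less_irrefl not_real_square_gt_zero)
  ultimately show False
    using u(1,2) xy
    by (metis add_nonneg_eq_0_iff diff_ge_0_iff_ge less_irrefl mult_eq_0_iff mult_nonneg_nonneg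
        order_less_imp_le eq_iff_diff_eq_0 zero_neq_one)
qed

text \<open>At parameter \<open>u\<close> on the way from \<open>a\<close> to \<open>d\<close> the
  determinant is \<open>u\<close> times its value at \<open>d\<close>, so it vanishes only at
  \<open>a\<close>.\<close>

lemma segments_common_end:
  assumes "orientation a b d \<noteq> 0"
  shows "closed_segment a b \<inter> closed_segment a d \<subseteq> {a}"
proof
  fix z assume "z \<in> closed_segment a b \<inter> closed_segment a d"
  then have z: "z \<in> closed_segment a b" "z \<in> closed_segment a d"
    by auto
  obtain u where u: "z = (1 - u) *\<^sub>R a + u *\<^sub>R d"
    "orientation a b z = (1 - u) * orientation a b a + u * orientation a b d"
    using orientation_convex[OF z(2)] by metis
  then have "u = 0"
    using orientation_segment[OF z(1)] assms by simp
  with u show "z \<in> {a}" by simp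
qed

section \<open>A drawing of infinitely many stellated tetrahedra\<close>

text \<open>
  \<open>(False, i)\<close> is the \<open>i\<close>-th corner of the tetrahedron and \<open>(True, i)\<close> is the vertex in the face
  opposite to it. The outer face of the drawing is \<open>(False, 0), (False, 1), (True, 3)\<close>. No edge is
  collinear with a third vertex, so that signs of determinants certify that no two edges cross.
\<close>

definition site :: "bool \<times> nat \<Rightarrow> int \<times> int" where
  "site = (\<lambda>(s, i). (if s then [(8, 4), (4, 4), (6, 1), (7, 20)]
                     else [(0, 0), (12, 0), (6, 9), (5, 3)]) ! i)"

text \<open>The integer version of \<open>orientation\<close>, whose sign can be found by
  evaluation.\<close>

definition det3 :: "int \<times> int \<Rightarrow> int \<times> int \<Rightarrow> int \<times> int \<Rightarrow> int" where
  "det3 = (\<lambda>(a1, a2) (b1, b2) (c1, c2). (b1 - a1) * (c2 - a2) - (b2 - a2) * (c1 - a1))"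

definition stellation_nodes :: "(bool \<times> nat) list" where
  "stellation_nodes = List.product [False, True] [0..<4]"

text \<open>The graph of the triakis tetrahedron. For \<open>s = False\<close> these are the six
  edges of the tetrahedron, for \<open>s = True\<close> the twelve edges from a face vertex
  \<open>j\<close> to the corners \<open>i\<close> other than \<open>j\<close>. Each edge is listed
  in one direction only.\<close>

definition stellation_edges :: "((bool \<times> nat) \<times> (bool \<times> nat)) list" where
  "stellation_edges = [((False, i), (s, j)).
     s \<leftarrow> [False, True], i \<leftarrow> [0..<4], j \<leftarrow> [0..<4], i < j \<or> s \<and> j < i]"

lemma set_stellation_nodes: "set stellation_nodes = UNIV \<times> {..<4}"
  by (auto simp: stellation_nodes_def)

lemma stellation_edges_nodes:
  "(u, v) \<in> set stellation_edges \<Longrightarrow> u \<in> set stellation_nodes \<and> v \<in> set stellation_nodes \<and> u \<noteq> v"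
  by (auto simp: stellation_edges_def stellation_nodes_def)

lemma site_range: "\<forall>u\<in>set stellation_nodes. 0 \<le> fst (site u) \<and> fst (site u) \<le> 12"
  by code_simp

lemma site_inj: "inj_on site (set stellation_nodes)"
proof -
  have "distinct (map site stellation_nodes)"
    by code_simp
  then show ?thesis
    by (simp add: distinct_map)
qed

lemma site_det3:
  "\<forall>(u, v)\<in>set stellation_edges. \<forall>w\<in>set stellation_nodes.
     w = u \<or> w = v \<or> det3 (site u) (site v) (site w) \<noteq> 0"
  by code_simp

text \<open>A finite check: of two edges without a common end, one has both ends strictly on the
  same side of the line through the other.\<close>

lemma site_cross:
  "\<forall>(u, v)\<in>set stellation_edges. \<forall>(w, z)\<in>set stellation_edges. u = w \<or> u = z \<or> v = w \<or> v = z \<or>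
     0 < det3 (site u) (site v) (site w) * det3 (site u) (site v) (site z) \<or>
     0 < det3 (site w) (site z) (site u) * det3 (site w) (site z) (site v)"
  by code_simp

text \<open>Copy \<open>k\<close> is shifted by \<open>20 * k\<close>. By \<open>site_range\<close>
  a copy has width at most 12, so the copies occupy disjoint vertical strips.\<close>

definition pos :: "nat \<times> bool \<times> nat \<Rightarrow> complex" where
  "pos = (\<lambda>(k, u). Complex (of_int (fst (site u)) + 20 * of_nat k) (of_int (snd (site u))))"

lemma orientation_pos:
  "orientation (pos (k, u)) (pos (k, v)) (pos (k, w)) = of_int (det3 (site u) (site v) (site w))"
  by (simp add: orientation_def pos_def det3_def split_beta algebra_simps)

text \<open>One copy for every natural number, so that any numbering of cosets can select
  copies.\<close>

definition stellations :: "(nat \<times> bool \<times> nat) ugraph" where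
  "stellations = (UNIV \<times> set stellation_nodes,
     {{(k, u), (k, v)} | k u v. (u, v) \<in> set stellation_edges})"

lemma pos_strip:
  assumes "u \<in> set stellation_nodes" "v \<in> set stellation_nodes"
    "z \<in> closed_segment (pos (k, u)) (pos (k, v))"
  shows "20 * real k \<le> Re z" "Re z \<le> 20 * real k + 12"
proof -
  have "convex {w. 20 * real k \<le> Re w}" "convex {w. Re w \<le> 20 * real k + 12}"
    by (simp_all add: convex_halfspace_Re_ge convex_halfspace_Re_le)
  moreover have "pos (k, w) \<in> {w. 20 * real k \<le> Re w}" "pos (k, w) \<in> {w. Re w \<le> 20 * real k + 12}"
    if "w \<in> set stellation_nodes" for w
    using bspec[OF site_range that] by (simp_all add: pos_def)
  ultimately have "z \<in> {w. 20 * real k \<le> Re w}" "z \<in> {w. Re w \<le> 20 * real k + 12}"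
    using assms closed_segment_subset by blast+
  then show "20 * real k \<le> Re z" "Re z \<le> 20 * real k + 12"
    by simp_all
qed

lemma pos_strip_unique:
  assumes "u \<in> set stellation_nodes" "v \<in> set stellation_nodes"
    "z \<in> closed_segment (pos (k, u)) (pos (k, v))"
    and "w \<in> set stellation_nodes" "x \<in> set stellation_nodes"
    "z \<in> closed_segment (pos (l, w)) (pos (l, x))"
  shows "k = l"
proof -
  have "20 * real k \<le> 20 * real l + 12" "20 * real l \<le> 20 * real k + 12"
    using pos_strip[OF assms(1-3)] pos_strip[OF assms(4-6)] by linarith+
  then show ?thesis
    by linarith
qed

lemma inj_on_pos: "inj_on pos (UNIV \<times> set stellation_nodes)"
proof (rule inj_onI)
  fix x y
  assume xy: "x \<in> UNIV \<times> set stellation_nodes" "y \<in> UNIV \<times> set stellation_nodes"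
    and eq: "pos x = pos y"
  obtain k u where x: "x = (k, u)" "u \<in> set stellation_nodes"
    using xy(1) by blast
  obtain l v where y: "y = (l, v)" "v \<in> set stellation_nodes"
    using xy(2) by blast
  have eq': "pos (k, u) = pos (l, v)"
    using eq unfolding x y .
  have kl: "k = l"
    using pos_strip_unique[OF x(2,2) _ y(2,2), of "pos (k, u)" k l] unfolding eq' by simp
  have "fst (site u) = fst (site v)" "snd (site u) = snd (site v)"
    using eq' unfolding kl pos_def by simp_all
  then have "u = v"
    using inj_onD[OF site_inj prod_eqI x(2) y(2)] by blast
  then show "x = y"
    unfolding x y kl by simp
qed

text \<open>By \<open>site_det3\<close>, \<open>w\<close> is off the line through \<open>u\<close>
  and \<open>v\<close>. Reversing a listed edge only changes the sign of the determinant, so both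
  directions are covered.\<close>

lemma pos_common_end:
  assumes uv: "(u, v) \<in> set stellation_edges \<or> (v, u) \<in> set stellation_edges"
    and w: "w \<in> set stellation_nodes" "w \<noteq> u" "w \<noteq> v"
  shows "closed_segment (pos (k, u)) (pos (k, v)) \<inter> closed_segment (pos (k, u)) (pos (k, w))
    \<subseteq> {pos (k, u)}"
    and "pos (k, w) \<notin> closed_segment (pos (k, u)) (pos (k, v))"
proof -
  have det: "orientation (pos (k, x)) (pos (k, y)) (pos (k, w)) \<noteq> 0"
    if "(x, y) \<in> set stellation_edges" "w \<noteq> x" "w \<noteq> y" for x y
  proof -
    have "\<forall>w\<in>set stellation_nodes. w = x \<or> w = y \<or> det3 (site x) (site y) (site w) \<noteq> 0"
      using bspec[OF site_det3 that(1)] by simp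
    then have "det3 (site x) (site y) (site w) \<noteq> 0"
      using that w by metis
    then show ?thesis
      by (simp add: orientation_pos)
  qed
  have "orientation (pos (k, u)) (pos (k, v)) (pos (k, w)) \<noteq> 0"
    using uv det[of u v] det[of v u] w orientation_swap[of "pos (k, u)" "pos (k, v)" "pos (k, w)"]
    by fastforce
  then show "closed_segment (pos (k, u)) (pos (k, v)) \<inter> closed_segment (pos (k, u)) (pos (k, w))
    \<subseteq> {pos (k, u)}" "pos (k, w) \<notin> closed_segment (pos (k, u)) (pos (k, v))"
    using segments_common_end orientation_segment by blast+
qed

lemma pos_disjoint:
  assumes "(u, v) \<in> set stellation_edges" "(w, x) \<in> set stellation_edges" "{u, v} \<inter> {w, x} = {}"
  shows "closed_segment (pos (k, u)) (pos (k, v)) \<inter> closed_segment (pos (k, w)) (pos (k, x)) = {}"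
proof -
  have "0 < det3 (site u) (site v) (site w) * det3 (site u) (site v) (site x) \<or>
     0 < det3 (site w) (site x) (site u) * det3 (site w) (site x) (site v)"
    using bspec[OF bspec[OF site_cross assms(1), unfolded prod.case] assms(2)] assms(3) by auto
  then have "0 < orientation (pos (k, u)) (pos (k, v)) (pos (k, w)) *
        orientation (pos (k, u)) (pos (k, v)) (pos (k, x)) \<or>
      0 < orientation (pos (k, w)) (pos (k, x)) (pos (k, u)) *
        orientation (pos (k, w)) (pos (k, x)) (pos (k, v))"
    unfolding orientation_pos by (simp flip: of_int_mult)
  then show ?thesis
    using segments_disjoint by blast
qed

lemma pos_cross:
  assumes e: "(u, v) \<in> set stellation_edges" and f: "(w, x) \<in> set stellation_edges"
    and ne: "{u, v} \<noteq> {w, x}"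
    and z: "z \<in> closed_segment (pos (k, u)) (pos (k, v))" "z \<in> closed_segment (pos (k, w)) (pos (k, x))"
  shows "\<exists>y\<in>{u, v} \<inter> {w, x}. z = pos (k, y)"
proof -
  have nodes: "u \<in> set stellation_nodes" "v \<in> set stellation_nodes"
    "w \<in> set stellation_nodes" "x \<in> set stellation_nodes" "u \<noteq> v" "w \<noteq> x"
    using stellation_edges_nodes[OF e] stellation_edges_nodes[OF f] by simp_all
  have common: "\<exists>y\<in>{u, v} \<inter> {w, x}. z = pos (k, y)"
    if "a \<in> {u, v} \<inter> {w, x}" "(a, b) \<in> set stellation_edges \<or> (b, a) \<in> set stellation_edges"
      "c \<in> set stellation_nodes" "c \<noteq> a" "c \<noteq> b"
      "z \<in> closed_segment (pos (k, a)) (pos (k, b))" "z \<in> closed_segment (pos (k, a)) (pos (k, c))" for a b c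
    using pos_common_end(1)[OF that(2-5)] that(1,6,7) by blast
  have z': "z \<in> closed_segment (pos (k, v)) (pos (k, u))" "z \<in> closed_segment (pos (k, x)) (pos (k, w))"
    using z by (simp_all add: closed_segment_commute)
  \<comment> \<open>Distinct edges are disjoint or share exactly one end; the last four cases say
    which end of each edge it is.\<close>
  consider "{u, v} \<inter> {w, x} = {}" | "u = w" "x \<noteq> v" | "u = x" "w \<noteq> v"
    | "v = w" "x \<noteq> u" | "v = x" "w \<noteq> u"
    using ne by blast
  then show ?thesis
  proof cases
    case 1
    then show ?thesis
      using pos_disjoint[OF e f] z by blast
  next
    case 2
    then show ?thesis
      using nodes e z by (intro common[of u v x]) simp_all
  next
    case 3
    then show ?thesis
      using nodes e z z' by (intro common[of u v w]) simp_all
  next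
    case 4
    then show ?thesis
      using nodes e z z' by (intro common[of v u x]) simp_all
  next
    case 5
    then show ?thesis
      using nodes e z z' by (intro common[of v u w]) simp_all
  qed
qed

lemma planar_stellations: "planar stellations"
  unfolding stellations_def
proof (rule planar_straight_line[where p = pos])
  let ?E = "{{(k, u), (k, v)} | k u v. (u, v) \<in> set stellation_edges}"
  show "inj_on pos (UNIV \<times> set stellation_nodes)"
    by (rule inj_on_pos)
  show "\<exists>x\<in>UNIV \<times> set stellation_nodes. \<exists>y\<in>UNIV \<times> set stellation_nodes.
      x \<noteq> y \<and> e = {x, y}" if "e \<in> ?E" for e
  proof -
    obtain k u v where "e = {(k, u), (k, v)}" "(u, v) \<in> set stellation_edges"
      using \<open>e \<in> ?E\<close> by blast
    then show ?thesis
      using stellation_edges_nodes[of u v]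
      by (intro bexI[where x = "(k, u)"] bexI[where x = "(k, v)"]) auto
  qed
  show "y \<in> e"
    if eE: "e \<in> ?E" and yV: "y \<in> UNIV \<times> set stellation_nodes"
      and "pos y \<in> convex hull (pos ` e)" for e y
  proof -
    obtain k u v where e: "e = {(k, u), (k, v)}" "(u, v) \<in> set stellation_edges"
      using eE by blast
    obtain l w where y: "y = (l, w)" "w \<in> set stellation_nodes"
      using yV by blast
    have seg: "pos (l, w) \<in> closed_segment (pos (k, u)) (pos (k, v))"
      using that(3) by (simp add: e y segment_convex_hull)
    \<comment> \<open>The single point is treated as the degenerate segment from \<open>w\<close> to
      \<open>w\<close> in copy \<open>l\<close>.\<close>
    moreover from this have "l = k"
      using pos_strip_unique[of w w "pos (l, w)" l u v k] y stellation_edges_nodes[OF e(2)] by simp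
    ultimately show ?thesis
      using pos_common_end(2)[of u v w k] e y by auto
  qed
  show "z \<in> pos ` (e \<inter> f)"
    if eE: "e \<in> ?E" and fE: "f \<in> ?E" and ne: "e \<noteq> f"
      and z: "z \<in> convex hull (pos ` e)" "z \<in> convex hull (pos ` f)" for e f z
  proof -
    obtain k u v where e: "e = {(k, u), (k, v)}" "(u, v) \<in> set stellation_edges"
      using eE by blast
    obtain l w x where f: "f = {(l, w), (l, x)}" "(w, x) \<in> set stellation_edges"
      using fE by blast
    have seg: "z \<in> closed_segment (pos (k, u)) (pos (k, v))" "z \<in> closed_segment (pos (l, w)) (pos (l, x))"
      using z by (simp_all add: e f segment_convex_hull)
    have "k = l"
      using pos_strip_unique[OF _ _ seg(1) _ _ seg(2)]
        stellation_edges_nodes[OF e(2)] stellation_edges_nodes[OF f(2)]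
      by simp
    moreover from this ne have "{u, v} \<noteq> {w, x}"
      using e f by (metis image_empty image_insert)
    ultimately obtain y where "y \<in> {u, v} \<inter> {w, x}" "z = pos (k, y)"
      using pos_cross[OF e(2) f(2)] seg by metis
    then show ?thesis
      using e f \<open>k = l\<close> by auto
  qed
qed

lemma stellations_edgeI:
  assumes "i \<noteq> j" "i < 4" "j < 4" "\<not> (s \<and> t)"
  shows "{(k, s, i), (k, t, j)} \<in> snd stellations"
proof -
  have "((s, i), (t, j)) \<in> set stellation_edges \<or> ((t, j), (s, i)) \<in> set stellation_edges"
    using assms by (cases s; cases t) (auto simp: stellation_edges_def)
  moreover have "{(k, s, i), (k, t, j)} = {(k, t, j), (k, s, i)}"
    by (rule insert_commute)
  ultimately show ?thesis
    unfolding stellations_def snd_conv by blast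
qed

section \<open>Involutions in 2-groups\<close>

lemma has_subgroup_isoI:
  assumes "group G" "group K" and hom: "h \<in> hom K G"
    and ker: "\<And>x. x \<in> carrier K \<Longrightarrow> h x = \<one>\<^bsub>G\<^esub> \<Longrightarrow> x = \<one>\<^bsub>K\<^esub>"
  shows "has_subgroup_iso G K"
proof -
  interpret group_hom K G h
    using assms by (simp add: group_hom_def group_hom_axioms_def)
  have "inj_on h (carrier K)"
    using ker by (simp add: inj_on_one_iff)
  then have "h \<in> iso K (G\<lparr>carrier := h ` carrier K\<rparr>)"
    using hom by (auto simp: iso_def bij_betw_def hom_def)
  then have "G\<lparr>carrier := h ` carrier K\<rparr> \<cong> K"
    using assms(2) group.iso_sym is_isoI by blast
  then show ?thesis
    using img_is_subgroup by (auto simp: has_subgroup_iso_def)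
qed

context group
begin

text \<open>The map sending \<open>(i, s)\<close> to the \<open>i\<close>-th power of
  \<open>r\<close>, times \<open>a\<close> if \<open>s\<close> holds, is multiplicative because
  moving \<open>a\<close> past a power of \<open>r\<close> inverts that power.\<close>

lemma has_dihedral_subgroup:
  assumes r: "r \<in> carrier G" "ord r = 4" and a: "a \<in> carrier G" "a \<otimes> a = \<one>"
    and ar: "a \<otimes> r \<otimes> a = inv r"
  shows "has_subgroup_iso G (dihedral_group 4)"
proof -
  define h where "h = (\<lambda>(i :: int, s). r [^] i \<otimes> (if s then a else \<one>))"
  have pow_eq: "r [^] i = r [^] j \<longleftrightarrow> 4 dvd j - i" for i j :: int
    using int_pow_eq[of r i j] r by simp
  have pow_mod: "r [^] (i mod 4) = r [^] i" for i :: int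
    by (simp add: pow_eq mod_eq_dvd_iff)
  have inva: "inv a = a"
    using a inv_equality by blast
  have conj: "a \<otimes> r [^] i = r [^] (- i) \<otimes> a" for i :: int
  proof -
    \<comment> \<open>This is conjugation by \<open>a\<close>, since \<open>a\<close> is its own
      inverse; as a homomorphism it inverts every power of \<open>r\<close> once it inverts
      \<open>r\<close>.\<close>
    have "(\<lambda>x. a \<otimes> x \<otimes> a) \<in> hom G G"
    proof (rule homI)
      fix x y assume "x \<in> carrier G" "y \<in> carrier G"
      then have "a \<otimes> x \<otimes> a \<otimes> (a \<otimes> y \<otimes> a) = a \<otimes> x \<otimes> ((a \<otimes> a) \<otimes> (y \<otimes> a))"
        using a(1) by (simp add: m_assoc)
      then show "a \<otimes> (x \<otimes> y) \<otimes> a = a \<otimes> x \<otimes> a \<otimes> (a \<otimes> y \<otimes> a)"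
        using a \<open>x \<in> carrier G\<close> \<open>y \<in> carrier G\<close> by (simp add: m_assoc)
    qed (use a in simp)
    then have "a \<otimes> r [^] i \<otimes> a = (a \<otimes> r \<otimes> a) [^] i"
      using hom_int_pow[OF _ r(1) is_group is_group] by blast
    also have "\<dots> = r [^] (- i)"
      using r by (simp add: ar int_pow_inv int_pow_neg)
    finally have "a \<otimes> r [^] i \<otimes> a \<otimes> a = r [^] (- i) \<otimes> a"
      by simp
    then show ?thesis
      using a r by (simp add: m_assoc)
  qed
  have "h \<in> hom (dihedral_group 4) G"
  proof (rule homI)
    fix x y assume "x \<in> carrier (dihedral_group 4)" "y \<in> carrier (dihedral_group 4)"
    obtain i s j t where [simp]: "x = (i, s)" "y = (j, t)"
      by (cases x, cases y)
    have "r [^] i \<otimes> a \<otimes> (r [^] j \<otimes> b) = r [^] (i - j) \<otimes> (a \<otimes> b)" if "b \<in> carrier G" for b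
    proof -
      have "r [^] i \<otimes> a \<otimes> (r [^] j \<otimes> b) = r [^] i \<otimes> (a \<otimes> r [^] j) \<otimes> b"
        using that a r by (simp add: m_assoc)
      also have "\<dots> = r [^] i \<otimes> r [^] (- j) \<otimes> (a \<otimes> b)"
        using that a r unfolding conj by (simp add: m_assoc)
      also have "r [^] i \<otimes> r [^] (- j) = r [^] (i - j)"
        using r by (simp flip: int_pow_mult)
      finally show ?thesis .
    qed
    from this[of \<one>] this[of a]
    show "h (x \<otimes>\<^bsub>dihedral_group 4\<^esub> y) = h x \<otimes> h y"
      using a r by (auto simp: h_def dihedral_group_def pow_mod int_pow_mult m_assoc)
  qed (use r a in \<open>auto simp: h_def\<close>)
  moreover have "h x = \<one> \<Longrightarrow> x = \<one>\<^bsub>dihedral_group 4\<^esub>" if "x \<in> carrier (dihedral_group 4)" for x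
  proof -
    obtain i s where x [simp]: "x = (i, s)"
      by (cases x)
    assume hx: "h x = \<one>"
    \<comment> \<open>Otherwise \<open>a\<close> is a power of \<open>r\<close> and commutes with
      it, so \<open>r\<close> is its own inverse, contrary to its order 4.\<close>
    have "\<not> s"
    proof
      assume s
      then have "r [^] i = a"
        using hx r a inva inv_equality[of "r [^] i" a] by (simp add: h_def)
      then have "a \<otimes> r = r \<otimes> a"
        using r by (metis int_pow_1 int_pow_mult add.commute)
      then have "inv r = r"
        using ar a r by (simp add: m_assoc)
      then have "r [^] (-1 :: int) = r [^] (1 :: int)"
        using r by (simp add: int_pow_neg)
      then show False
        unfolding pow_eq by simp
    qed
    moreover have "i = 0"
    proof -
      have "r [^] i = r [^] (0 :: int)"
        using hx \<open>\<not> s\<close> r by (simp add: h_def)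
      then have "4 dvd i"
        unfolding pow_eq by simp
      then show ?thesis
        using that by (auto simp: dihedral_group_def elim!: dvdE)
    qed
    ultimately show ?thesis
      by (simp add: dihedral_group_def)
  qed
  ultimately show ?thesis
    by (intro has_subgroup_isoI is_group group_dihedral_group) auto
qed

lemma involutions_commute:
  assumes "order G = 2 ^ n" and D: "\<not> has_subgroup_iso G (dihedral_group 4)"
    and a: "a \<in> carrier G" "a \<otimes> a = \<one>" and b: "b \<in> carrier G" "b \<otimes> b = \<one>"
  shows "a \<otimes> b = b \<otimes> a"
proof (rule ccontr)
  assume ne: "a \<otimes> b \<noteq> b \<otimes> a"
  define r where "r = a \<otimes> b"
  have r: "r \<in> carrier G"
    using a b by (simp add: r_def)
  have inva: "inv a = a" "inv b = b"
    using a b inv_equality by blast+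
  have invr: "inv r = b \<otimes> a"
    using a b by (simp add: r_def inv_mult_group inva)
  have "ord r dvd 2 ^ n"
    using ord_dvd_group_order[OF r] assms(1) by simp
  then obtain m where m: "ord r = 2 ^ m"
    using divides_primepow_nat[of 2] two_is_prime_nat by blast
  \<comment> \<open>Otherwise \<open>r\<close> equals its inverse \<open>b \<otimes> a\<close>, that
    is, \<open>a\<close> and \<open>b\<close> commute.\<close>
  have "\<not> ord r dvd 2"
  proof
    assume "ord r dvd 2"
    then have "r \<otimes> r = \<one>"
      using pow_eq_id[OF r, of 2] r by (simp add: numeral_2_eq_2)
    then have "inv r = r"
      using r inv_equality by blast
    then show False
      using ne invr r_def by simp
  qed
  then have "2 \<le> m"
    using m by (metis One_nat_def le_imp_power_dvd not_less_eq_eq numeral_2_eq_2 power_one_right)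
  \<comment> \<open>The exponent is chosen to reduce the order from \<open>2 ^ m\<close> to
    4.\<close>
  define q where "q = r [^] ((2 :: nat) ^ (m - 2))"
  have "ord q = 2 ^ m div 2 ^ (m - 2)"
    unfolding q_def using ord_pow[OF r, of "2 ^ (m - 2)"] m by (simp add: le_imp_power_dvd)
  also have "\<dots> = 4"
    using \<open>2 \<le> m\<close> by (simp flip: power_diff)
  finally have q: "ord q = 4" .
  have conj: "a \<otimes> r [^] k \<otimes> a = inv (r [^] k)" for k :: nat
  proof (induction k)
    case (Suc k)
    have "a \<otimes> r [^] Suc k \<otimes> a = a \<otimes> r [^] k \<otimes> r \<otimes> a"
      using a r by (simp add: m_assoc)
    \<comment> \<open>Inserting \<open>a \<otimes> a\<close> splits the conjugate of a product into
      a product of conjugates.\<close>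
    also have "\<dots> = a \<otimes> r [^] k \<otimes> (a \<otimes> a) \<otimes> r \<otimes> a"
      using a r by (simp)
    also have "\<dots> = (a \<otimes> r [^] k \<otimes> a) \<otimes> (a \<otimes> r \<otimes> a)"
      using a(1) r by (simp add: m_assoc)
    also have "a \<otimes> r \<otimes> a = inv r"
      using a b by (simp add: invr) (simp add: r_def flip: m_assoc)
    also have "a \<otimes> r [^] k \<otimes> a \<otimes> inv r = inv (r \<otimes> r [^] k)"
      using r by (simp add: Suc inv_mult_group)
    also have "r \<otimes> r [^] k = r [^] Suc k"
      using r by (metis nat_pow_Suc2)
    finally show ?case .
  qed (use a in simp)
  show False
    using has_dihedral_subgroup[OF _ q a] conj r D by (simp add: q_def)
qed

text \<open>The seven inequalities say that none of the seven nontrivial products of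
  \<open>a\<close>, \<open>b\<close>, \<open>c\<close> is the identity, which makes the kernel of
  \<open>h\<close> trivial.\<close>

lemma has_elementary_subgroup:
  assumes a: "a \<in> carrier G" "a \<otimes> a = \<one>" and b: "b \<in> carrier G" "b \<otimes> b = \<one>"
    and c: "c \<in> carrier G" "c \<otimes> c = \<one>"
    and comm: "a \<otimes> b = b \<otimes> a" "a \<otimes> c = c \<otimes> a" "b \<otimes> c = c \<otimes> b"
    and ne: "a \<noteq> \<one>" "b \<noteq> \<one>" "b \<noteq> a" "c \<noteq> \<one>" "c \<noteq> a" "c \<noteq> b" "c \<noteq> a \<otimes> b"
  shows "has_subgroup_iso G
           (integer_mod_group 2 \<times>\<times> integer_mod_group 2 \<times>\<times> integer_mod_group 2)"
    (is "has_subgroup_iso G ?Z")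
proof -
  define h where "h = (\<lambda>(i :: int, j :: int, k :: int). a [^] i \<otimes> (b [^] j \<otimes> c [^] k))"
  have Z: "group ?Z"
    by (intro DirProd_group group_integer_mod_group)
  have inv: "inv a = a" "inv b = b" "inv c = c"
    using a b c inv_equality by blast+
  have bits: "{0..<2 :: int} = {0, 1}"
    by auto
  \<comment> \<open>Rewrite rules that sort a product of the three commuting elements and cancel
    squares.\<close>
  have lc: "b \<otimes> (a \<otimes> x) = a \<otimes> (b \<otimes> x)" "c \<otimes> (a \<otimes> x) = a \<otimes> (c \<otimes> x)"
    "c \<otimes> (b \<otimes> x) = b \<otimes> (c \<otimes> x)" "a \<otimes> (a \<otimes> x) = x" "b \<otimes> (b \<otimes> x) = x"
    "c \<otimes> (c \<otimes> x) = x"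
    if "x \<in> carrier G" for x
    using that a b c comm by (simp_all flip: m_assoc)
  have "h \<in> hom ?Z G"
  proof (rule homI)
    fix x y assume "x \<in> carrier ?Z" "y \<in> carrier ?Z"
    then show "h (x \<otimes>\<^bsub>?Z\<^esub> y) = h x \<otimes> h y"
      using a b c lc comm[symmetric]
      by (auto simp: h_def carrier_integer_mod_group bits m_assoc)
  qed (use a b c in \<open>auto simp: h_def\<close>)
  moreover have "h x = \<one> \<Longrightarrow> x = \<one>\<^bsub>?Z\<^esub>" if "x \<in> carrier ?Z" for x
  proof -
    have "b \<otimes> c \<noteq> \<one>" "a \<otimes> c \<noteq> \<one>" "a \<otimes> b \<noteq> \<one>" "a \<otimes> (b \<otimes> c) \<noteq> \<one>"
      using a b c ne inv inv_equality[of b c] inv_equality[of a c] inv_equality[of a b]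
        inv_equality[of "a \<otimes> b" c] by (auto simp: m_assoc)
    then show "h x = \<one> \<Longrightarrow> x = \<one>\<^bsub>?Z\<^esub>"
      using that a b c ne by (auto simp: h_def carrier_integer_mod_group bits)
  qed
  ultimately show ?thesis
    by (rule has_subgroup_isoI[OF is_group Z])
qed

section \<open>Embedding the graph coset by coset\<close>

lemma planar_product_in_normal:
  assumes fin: "finite (carrier G)" and "N \<lhd> G" and card: "card N \<le> 4"
    and E: "\<And>e. e \<in> E \<Longrightarrow> \<exists>x\<in>carrier G. \<exists>y\<in>carrier G.
              e = {x, y} \<and> x \<noteq> y \<and> x \<otimes> y \<in> N \<and> x \<otimes> y \<noteq> \<one>"
  shows "planar (carrier G, E)"
proof -
  interpret normal N G
    by fact
  have sub: "N \<subseteq> carrier G"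
    by (rule subset)
  have "finite (rcosets N)"
    using fin by (simp add: RCOSETS_def)
  \<comment> \<open>The number of a coset selects a copy of the stellated tetrahedron and decides
    between a coset and its inverse.\<close>
  then obtain f :: "'a set \<Rightarrow> nat" where f: "inj_on f (rcosets N)"
    using finite_imp_inj_to_nat_seg by metis
  have "\<exists>l. inj_on l C \<and> l ` C \<subseteq> {..<4 :: nat}" if "C \<in> rcosets N" for C
  proof -
    have "card C \<le> card {..<4 :: nat}" "finite C"
      using that card card_rcosets_equal[OF that sub] rcosets_finite[OF that sub] fin
        finite_subset[OF sub fin] by auto
    then show ?thesis
      using card_le_inj[of C "{..<4 :: nat}"] by auto
  qed
  then obtain l where l: "\<And>C. C \<in> rcosets N \<Longrightarrow> inj_on (l C) C \<and> l C ` C \<subseteq> {..<4 :: nat}"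
    by metis
  define \<kappa> where "\<kappa> y = f (N #> y)" for y
  \<comment> \<open>Of \<open>y\<close> and its inverse, the one whose coset has the smaller number;
    in a tie \<open>y\<close> itself.\<close>
  define rep where "rep y = (if \<kappa> y \<le> \<kappa> (inv y) then y else inv y)" for y
  \<comment> \<open>The flag holds exactly if \<open>y\<close> was inverted. A self-inverse coset
    thus occupies corners only; of two mutually inverse cosets, the one with the smaller number goes
    to corners and the other to face vertices.\<close>
  define \<phi> where "\<phi> y = (\<kappa> (rep y), \<kappa> (inv y) < \<kappa> y, l (N #> rep y) (rep y))" for y
  have coset: "N #> y \<in> rcosets N" "y \<in> N #> y" if "y \<in> carrier G" for y
    using that sub rcosetsI rcos_self[OF that is_subgroup] by auto
  have \<kappa>_eq: "\<kappa> y = \<kappa> z \<longleftrightarrow> N #> y = N #> z" if "y \<in> carrier G" "z \<in> carrier G" for y z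
    using that coset f by (auto simp: \<kappa>_def dest: inj_onD)
  have rep: "rep y \<in> carrier G" if "y \<in> carrier G" for y
    using that by (simp add: rep_def)
  have label_eq: "y = z" if "y \<in> carrier G" "z \<in> carrier G" "N #> y = N #> z"
    "l (N #> y) y = l (N #> z) z" for y z
    using that l[OF coset(1)[OF that(1)]] coset(2)[OF that(1)] coset(2)[OF that(2)]
    by (metis inj_onD)
  have label_less: "l (N #> y) y < 4" if "y \<in> carrier G" for y
    using l[OF coset(1)[OF that]] coset(2)[OF that] by auto
  have inj: "inj_on \<phi> (carrier G)"
  proof (rule inj_onI)
    fix y z assume yz: "y \<in> carrier G" "z \<in> carrier G" and "\<phi> y = \<phi> z"
    then have eq: "\<kappa> (rep y) = \<kappa> (rep z)" "\<kappa> (inv y) < \<kappa> y \<longleftrightarrow> \<kappa> (inv z) < \<kappa> z"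
      "l (N #> rep y) (rep y) = l (N #> rep z) (rep z)"
      by (simp_all add: \<phi>_def)
    \<comment> \<open>Coset number and label determine the representative; the flag then tells
      whether it was inverted.\<close>
    then have "rep y = rep z"
      using label_eq[OF rep rep] \<kappa>_eq[OF rep rep] yz by blast
    then show "y = z"
      using yz eq(2) by (auto simp: rep_def not_le split: if_splits)
  qed
  have range: "\<phi> ` carrier G \<subseteq> fst stellations"
    using label_less rep by (auto simp: \<phi>_def stellations_def set_stellation_nodes)
  have edge: "\<phi> ` {y, z} \<in> snd stellations"
    if yz: "y \<in> carrier G" "z \<in> carrier G" "y \<noteq> z" "y \<otimes> z \<in> N" "y \<otimes> z \<noteq> \<one>" for y z
  proof -
    have invz: "N #> inv z = N #> y"
      using yz rcos_module[of "inv z" y] repr_independence[of y N "inv z"] is_subgroup is_group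
      by auto
    have invy: "N #> inv y = N #> z"
    proof -
      \<comment> \<open>Normality enters here: \<open>z \<otimes> y\<close> is a conjugate of
        \<open>y \<otimes> z\<close>.\<close>
      have "z \<otimes> y = inv y \<otimes> (y \<otimes> z) \<otimes> y"
        using yz by (simp flip: m_assoc)
      then have "z \<otimes> y \<in> N"
        using yz inv_op_closed1 by (metis (no_types))
      then show ?thesis
        using yz rcos_module[of "inv y" z] repr_independence[of z N "inv y"] is_subgroup is_group
        by auto
    qed
    have \<kappa>: "\<kappa> (inv z) = \<kappa> y" "\<kappa> (inv y) = \<kappa> z"
      using invz invy by (simp_all add: \<kappa>_def)
    \<comment> \<open>If \<open>y\<close> and \<open>z\<close> lie in one coset, neither is inverted
      and \<open>y \<noteq> z\<close> suffices. Otherwise exactly one is inverted, and equality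
      would give \<open>y \<otimes> z = \<one>\<close>.\<close>
    have "rep y \<noteq> rep z"
    proof -
      have "y \<noteq> inv z" "inv y \<noteq> z"
        using yz by auto
      then show ?thesis
        using yz \<kappa> by (auto simp: rep_def)
    qed
    moreover have rep_coset: "\<kappa> (rep y) = \<kappa> (rep z)"
      using \<kappa> by (auto simp: rep_def)
    ultimately have "l (N #> rep y) (rep y) \<noteq> l (N #> rep z) (rep z)"
      using label_eq[OF rep rep] yz \<kappa>_eq[OF rep rep] by blast
    \<comment> \<open>The flags of \<open>y\<close> and \<open>z\<close> are the opposite strict
      inequalities between \<open>\<kappa> y\<close> and \<open>\<kappa> z\<close>, so they never
      both hold.\<close>
    then show ?thesis
      using stellations_edgeI[OF _ label_less[OF rep] label_less[OF rep]] yz rep_coset \<kappa>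
      by (simp add: \<phi>_def)
  qed
  show ?thesis
  proof (rule planar_embedding[OF _ inj range])
    show "planar (fst stellations, snd stellations)"
      using planar_stellations by simp
    show "e \<subseteq> carrier G \<and> \<phi> ` e \<in> snd stellations" if "e \<in> E" for e
      using E[OF that] edge by (metis empty_subsetI insert_subset)
  qed
qed

section \<open>The normal subgroup of involutions\<close>

text \<open>With more than four elements available, \<open>a\<close>, \<open>b\<close>,
  \<open>c\<close> can be picked one after another, each outside the subgroup generated by the
  previous ones.\<close>

lemma card_commuting_involutions:
  assumes fin: "finite (carrier G)"
    and comm: "\<And>a b. a \<in> carrier G \<Longrightarrow> b \<in> carrier G \<Longrightarrow> a \<otimes> a = \<one> \<Longrightarrow> b \<otimes> b = \<one> \<Longrightarrow>
                 a \<otimes> b = b \<otimes> a"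
    and Z: "\<not> has_subgroup_iso G
           (integer_mod_group 2 \<times>\<times> integer_mod_group 2 \<times>\<times> integer_mod_group 2)"
  shows "card {x \<in> carrier G. x \<otimes> x = \<one>} \<le> 4"
proof (rule ccontr)
  let ?N = "{x \<in> carrier G. x \<otimes> x = \<one>}"
  assume large: "\<not> card ?N \<le> 4"
  have extend: "\<exists>x\<in>?N. x \<notin> F" if "card F \<le> 4" "finite F" for F
    using large card_mono[OF that(2), of ?N] that(1) by (meson le_trans subsetI)
  obtain a where a: "a \<in> ?N" "a \<notin> {\<one>}"
    using extend[of "{\<one>}"] by auto
  obtain b where b: "b \<in> ?N" "b \<notin> {\<one>, a}"
    using extend[of "{\<one>, a}"] card_length[of "[\<one>, a]"] by auto
  \<comment> \<open>The length of a list bounds the size of its set, so distinctness of the four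
    elements need not be shown.\<close>
  have "card {\<one>, a, b, a \<otimes> b} \<le> 4"
    using card_length[of "[\<one>, a, b, a \<otimes> b]"] by simp
  then obtain c where c: "c \<in> ?N" "c \<notin> {\<one>, a, b, a \<otimes> b}"
    using extend[of "{\<one>, a, b, a \<otimes> b}"] by blast
  show False
    using has_elementary_subgroup[of a b c] a b c comm Z by auto
qed

text \<open>Commutation gives closure under products; conjugation preserves the equation
  \<open>x \<otimes> x = \<one>\<close>.\<close>

lemma commuting_involutions_normal:
  assumes comm: "\<And>a b. a \<in> carrier G \<Longrightarrow> b \<in> carrier G \<Longrightarrow> a \<otimes> a = \<one> \<Longrightarrow> b \<otimes> b = \<one> \<Longrightarrow>
                 a \<otimes> b = b \<otimes> a"
  shows "{x \<in> carrier G. x \<otimes> x = \<one>} \<lhd> G" (is "?N \<lhd> G")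
  unfolding normal_inv_iff
proof (intro conjI ballI)
  show "subgroup ?N G"
  proof (rule subgroupI)
    fix a b assume "a \<in> ?N" "b \<in> ?N"
    then have ab: "a \<in> carrier G" "b \<in> carrier G" "a \<otimes> a = \<one>" "b \<otimes> b = \<one>"
      by auto
    then have "a \<otimes> b \<otimes> (a \<otimes> b) = a \<otimes> b \<otimes> (b \<otimes> a)"
      using comm by simp
    also have "\<dots> = a \<otimes> (b \<otimes> b) \<otimes> a"
      using ab(1,2) by (simp add: m_assoc)
    finally show "a \<otimes> b \<in> ?N"
      using ab by simp
  next
    fix a assume "a \<in> ?N"
    then show "inv a \<in> ?N"
      using inv_equality[of a a] by auto
  qed auto
  fix x h assume "x \<in> carrier G" "h \<in> ?N"
  then have xh: "x \<in> carrier G" "h \<in> carrier G" "h \<otimes> h = \<one>"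
    by auto
  have "inv x \<otimes> (x \<otimes> y) = y" if "y \<in> carrier G" for y
    using that xh by (simp flip: m_assoc)
  then have "x \<otimes> h \<otimes> inv x \<otimes> (x \<otimes> h \<otimes> inv x) = x \<otimes> (h \<otimes> h) \<otimes> inv x"
    using xh(1,2) by (simp add: m_assoc)
  then show "x \<otimes> h \<otimes> inv x \<in> ?N"
    using xh by simp
qed

text \<open>A prime dividing a power of 2 divides 2, and the identity has order 1, which is not
  prime.\<close>

lemma prime_ord_two_group:
  assumes "order G = 2 ^ n" "x \<in> carrier G" "Factorial_Ring.prime (ord x)"
  shows "x \<otimes> x = \<one>" "x \<noteq> \<one>"
proof -
  have "ord x dvd 2 ^ n"
    using ord_dvd_group_order[OF assms(2)] assms(1) by simp
  then have "ord x dvd 2"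
    using assms(3) prime_dvd_power by blast
  then have "x [^] (2 :: nat) = \<one>"
    using pow_eq_id[OF assms(2)] by simp
  then show "x \<otimes> x = \<one>"
    using assms(2) by (simp add: numeral_2_eq_2)
  show "x \<noteq> \<one>"
    using assms(3) by auto
qed

end

theorem theorem4p2:
  fixes G :: "('a, 'b) monoid_scheme" and n :: nat
  assumes "group G" and "finite (carrier G)" and "order G = 2 ^ n"
    and "\<not> has_subgroup_iso G (dihedral_group 4)"
    and "\<not> has_subgroup_iso G
           (integer_mod_group 2 \<times>\<times> integer_mod_group 2 \<times>\<times> integer_mod_group 2)"
  shows "planar (prime_order_element_graph G)"
proof -
  interpret group G
    by fact
  let ?N = "{x \<in> carrier G. x \<otimes>\<^bsub>G\<^esub> x = \<one>\<^bsub>G\<^esub>}"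
  note comm = involutions_commute[OF assms(3,4)]
  have "?N \<lhd> G"
    by (rule commuting_involutions_normal[OF comm])
  moreover have "card ?N \<le> 4"
    by (rule card_commuting_involutions[OF assms(2) comm assms(5)])
  ultimately show ?thesis
    unfolding prime_order_element_graph_def
  proof (rule planar_product_in_normal[OF assms(2)])
    fix e
    assume "e \<in> {{x, y} | x y. x \<in> carrier G \<and> y \<in> carrier G \<and> x \<noteq> y \<and>
      Factorial_Ring.prime (ord (x \<otimes>\<^bsub>G\<^esub> y))}"
    then obtain x y where xy: "e = {x, y}" "x \<in> carrier G" "y \<in> carrier G" "x \<noteq> y"
      and "Factorial_Ring.prime (ord (x \<otimes>\<^bsub>G\<^esub> y))"
      by blast
    then have "x \<otimes>\<^bsub>G\<^esub> y \<in> ?N" "x \<otimes>\<^bsub>G\<^esub> y \<noteq> \<one>\<^bsub>G\<^esub>"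
      using prime_ord_two_group[OF assms(3) m_closed[OF xy(2,3)]] by simp_all
    with xy show "\<exists>x\<in>carrier G. \<exists>y\<in>carrier G.
        e = {x, y} \<and> x \<noteq> y \<and> x \<otimes>\<^bsub>G\<^esub> y \<in> ?N \<and> x \<otimes>\<^bsub>G\<^esub> y \<noteq> \<one>\<^bsub>G\<^esub>"
      by blast
  qed
qed

end
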